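(* Let $k\geq 2$ be a positive integer, and let $\mathcal{F}_k$ be the family of all $\lambda$-tents $\Delta_\lambda$, where $\lambda$ ranges over the partitions with $|\lambda|=k$ and $\ell(\lambda)=2$. Then $\pi(\mathcal{F}_k)=k!/k^k$.
   Context: A $k$-graph is a finite $k$-uniform hypergraph. For a family $\mathcal{F}$ of $k$-graphs, $\mathrm{ex}(n,\mathcal{F})$ is the maximum number of edges of a $k$-graph on $n$ vertices that contains no (not necessarily induced) subgraph isomorphic to a member of $\mathcal{F}$, and the Turán density is $\pi(\mathcal{F})=\lim_{n\to\infty}\mathrm{ex}(n,\mathcal{F})/\binom nk$. A partition $\lambda=(\lambda_1,\ldots,\lambda_\ell)$ of $k$ is a sequence of positive integers $\lambda_1\geq\cdots\geq\lambda_\ell$ with $|\lambda|=\sum_i\lambda_i=k$; its length is $\ell(\lambda)=\ell$. For a partition $\lambda$ of $k$ with $\ell=\ell(\lambda)\geq2$, the $\lambda$-tent $\Delta_\lambda$ is the $k$-graph (unique up to isomorphism) whose edges are $e,e_1,\ldots,e_\ell$ (each of size $k$) and whose vertices are exactly those lying in these edges, with a distinguished vertex $v\notin e$, such that: $v\in e_i$ and $|e_i\cap e|=\lambda_i$ for every $i\in\{1,\ldots,\ell\}$, and $e_i\cap e_j=\{v\}$ for all $i\neq j$. (In particular $e\cap e_1,\ldots,e\cap e_\ell$ partition $e$.) The edge $e$ is called the base and $v$ the apex. *)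

theory Defs
  imports Complex_Main
begin

record 'a hypergraph =
  verts :: "'a set"
  edges :: "'a set set"

definition kgraph :: "nat \<Rightarrow> 'a hypergraph \<Rightarrow> bool" where
  "kgraph k G \<longleftrightarrow> finite (verts G) \<and> (\<forall>e\<in>edges G. e \<subseteq> verts G \<and> card e = k)"

definition subgraph :: "'a hypergraph \<Rightarrow> 'a hypergraph \<Rightarrow> bool" where
  "subgraph H G \<longleftrightarrow>
     verts H \<subseteq> verts G \<and> edges H \<subseteq> edges G \<and> (\<forall>e\<in>edges H. e \<subseteq> verts H)"

definition isomorphic :: "'a hypergraph \<Rightarrow> 'b hypergraph \<Rightarrow> bool" where
  "isomorphic G H \<longleftrightarrow>
     (\<exists>f. bij_betw f (verts G) (verts H) \<and> edges H = (\<lambda>e. f ` e) ` edges G)"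

definition free_of :: "'a hypergraph set \<Rightarrow> 'b hypergraph \<Rightarrow> bool" where
  "free_of \<F> G \<longleftrightarrow> \<not> (\<exists>F\<in>\<F>. \<exists>H. subgraph H G \<and> isomorphic F H)"

text \<open>Every finite hypergraph is isomorphic to one whose vertices are natural numbers,
  so the maximum may be taken over hypergraphs on sets of natural numbers.\<close>

definition ex_number :: "nat \<Rightarrow> nat \<Rightarrow> 'a hypergraph set \<Rightarrow> nat" where
  "ex_number k n \<F> =
     Max {card (edges G) | G :: nat hypergraph.
            kgraph k G \<and> card (verts G) = n \<and> free_of \<F> G}"

definition turan_ratio :: "nat \<Rightarrow> 'a hypergraph set \<Rightarrow> nat \<Rightarrow> real" where
  "turan_ratio k \<F> n = real (ex_number k n \<F>) / real (n choose k)"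

definition turan_density :: "nat \<Rightarrow> 'a hypergraph set \<Rightarrow> real" where
  "turan_density k \<F> = lim (turan_ratio k \<F>)"

definition is_partition :: "nat \<Rightarrow> nat list \<Rightarrow> bool" where
  "is_partition k p \<longleftrightarrow>
     sorted_wrt (\<ge>) p \<and> (\<forall>x\<in>set p. 0 < x) \<and> sum_list p = k"

text \<open>The tent is determined only up to isomorphism, so it is given as a predicate that
  holds for all its isomorphic copies. The parts, and with them the edges other than the
  base, are indexed from 0.\<close>

definition is_tent :: "nat list \<Rightarrow> 'a hypergraph \<Rightarrow> bool" where
  "is_tent p T \<longleftrightarrow>
     is_partition (sum_list p) p \<and> 2 \<le> length p \<and>
     (\<exists>v b d.
        edges T = insert b (d ` {..<length p}) \<and>
        verts T = \<Union> (edges T) \<and>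
        (\<forall>a\<in>edges T. card a = sum_list p) \<and>
        v \<notin> b \<and>
        (\<forall>i<length p. v \<in> d i \<and> card (d i \<inter> b) = p ! i) \<and>
        (\<forall>i<length p. \<forall>j<length p. i \<noteq> j \<longrightarrow> d i \<inter> d j = {v}))"

definition two_part_tents :: "nat \<Rightarrow> nat hypergraph set" where
  "two_part_tents k =
     {T. \<exists>p. is_partition k p \<and> length p = 2 \<and> is_tent p T}"

end

theory Submission
  imports Defs "HOL-Library.FuncSet" "HOL-Combinatorics.Permutations"
begin

text \<open>The extremal configurations for the two-part tents are the complete \<open>k\<close>-partite \<open>k\<close>-graphs.
Such a graph is tent-free: the apex of a tent shares its vertex class with some vertex \<open>u\<close> of the
base, and an edge through the apex that contains \<open>u\<close> would meet that class twice.

For the upper bound, call three edges \<open>e, f, g\<close> entangled if \<open>e \<subseteq> f \<union> g\<close> and \<open>f \<inter> g\<close> has a vertex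
outside \<open>e\<close>.  These are the homomorphic images of the two-part tents: a tent has in addition
\<open>f \<inter> g = {v}\<close>.  The difference costs only \<open>O(n ^ (k - 1))\<close> edges
(\<open>entangled_heavy_imp_contains_tent\<close>, \<open>card_edges_with_light_le\<close>).  Call a set \<open>S\<close> with
\<open>2 \<le> card S < k\<close> light if its degree has order at most \<open>n ^ (k - card S - 1)\<close>.  Few edges contain a
light set.  Once they are deleted, in an entangled triple the set \<open>insert v (e - f) \<subseteq> g\<close> is an edge or
lies in so many edges that one of them avoids all other vertices of \<open>e\<close> and \<open>f\<close>; this edge
replaces \<open>g\<close> and completes a tent.

It remains to bound a \<open>k\<close>-uniform family \<open>E\<close> on \<open>n\<close> vertices without entangled triple by
\<open>(n / k) ^ k\<close>, which holds for every \<open>n\<close> (\<open>not_entangled_card_le\<close>).  The argument uses entropy.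
Let \<open>(X\<^sub>1, \<dots>, X\<^sub>k)\<close> be a uniformly random edge in uniformly random order and let \<open>y\<^sub>i\<close> be the exponential of
the entropy of one vertex conditioned on \<open>k - i\<close> others.  By the chain rule
\<open>y\<^sub>1 \<cdots> y\<^sub>k = k! * card E\<close>, and \<open>y\<^sub>k \<le> n\<close>.

The heart of the proof is \<open>y\<^sub>i + y\<^sub>j \<le> y\<^sub>i\<^sub>+\<^sub>j\<close> (\<open>cond_size_superadditive\<close>).  Given a random edge \<open>e\<close> and
disjoint subsets \<open>B, B'\<close> of sizes \<open>i, j\<close>, resample a vertex conditioned on \<open>e - B\<close>, or one conditioned on
\<open>e - B'\<close>.  The two results have disjoint supports, since a common value would entangle \<open>e\<close> with the two edges
that witness it.  So the best mixture of the two distributions has entropy \<open>ln (y\<^sub>i + y\<^sub>j)\<close>.  Conditioned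
on \<open>e - (B \<union> B')\<close> only, either choice is distributed like a further vertex of a random edge, so this
entropy is at most \<open>ln y\<^sub>i\<^sub>+\<^sub>j\<close>.

Superadditivity implies \<open>\<Sum>i=1..k. y\<^sub>i / i \<le> y\<^sub>k \<le> n\<close> (\<open>superadditive_sum_le\<close>), and the inequality of
arithmetic and geometric means gives \<open>k! * card E = y\<^sub>1 \<cdots> y\<^sub>k \<le> k! * (n / k) ^ k\<close>.\<close>

section \<open>Entangled triples and random labellings of edges\<close>
definition entangled :: "'a set set \<Rightarrow> bool" where
  "entangled E \<longleftrightarrow> (\<exists>e\<in>E. \<exists>f\<in>E. \<exists>g\<in>E. e \<subseteq> f \<union> g \<and> \<not> f \<inter> g \<subseteq> e)"

lemma entangledE:
  assumes "entangled E"
  obtains e f g v where "e \<in> E" "f \<in> E" "g \<in> E" "e \<subseteq> f \<union> g" "v \<in> f" "v \<in> g" "v \<notin> e"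
  using assms unfolding entangled_def by blast

locale uniform_family =
  fixes k :: nat and E :: "'a set set"
  assumes k_pos: "0 < k"
    and finite_E: "finite E"
    and card_edge: "e \<in> E \<Longrightarrow> card e = k"
begin

text \<open>A labelling is an edge with an order on its vertices.  It is fixed outside \<open>{..<k}\<close>, so that there are
exactly \<open>k!\<close> of them for each edge.\<close>
definition labellings :: "(nat \<Rightarrow> 'a) set" where
  "labellings = {x \<in> extensional {..<k}. x ` {..<k} \<in> E}"

text \<open>The labellings that agree with \<open>x\<close> on \<open>I\<close> are the outcomes that stay possible once the vertices at
the positions in \<open>I\<close> are revealed.\<close>
definition agreeing :: "nat set \<Rightarrow> (nat \<Rightarrow> 'a) \<Rightarrow> (nat \<Rightarrow> 'a) set" where
  "agreeing I x = {y \<in> labellings. \<forall>i\<in>I. y i = x i}"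

abbreviation num :: "nat set \<Rightarrow> (nat \<Rightarrow> 'a) \<Rightarrow> real" where
  "num I x \<equiv> real (card (agreeing I x))"

abbreviation N :: real where
  "N \<equiv> real (card labellings)"

text \<open>The Shannon entropy of the restriction to \<open>I\<close> of a uniformly random labelling: this restriction has
probability \<open>num I x / N\<close>.\<close>
definition entropy :: "nat set \<Rightarrow> real" where
  "entropy I = (\<Sum>x\<in>labellings. ln N - ln (num I x)) / N"

lemma finite_edge: "e \<in> E \<Longrightarrow> finite e"
  using card_edge k_pos card.infinite by fastforce

lemma finite_labellings: "finite labellings"
proof (rule finite_subset)
  show "labellings \<subseteq> {..<k} \<rightarrow>\<^sub>E \<Union>E"
    by (auto simp: labellings_def PiE_def)
  show "finite ({..<k} \<rightarrow>\<^sub>E \<Union>E)"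
    by (intro finite_PiE finite_Union) (auto simp: finite_E finite_edge)
qed

lemma finite_agreeing [simp]: "finite (agreeing I x)"
  using finite_labellings by (simp add: agreeing_def)

lemma labelling_inj: "x \<in> labellings \<Longrightarrow> inj_on x {..<k}"
  by (rule eq_card_imp_inj_on) (auto simp: labellings_def card_edge)

lemma num_pos: "x \<in> labellings \<Longrightarrow> 0 < num I x"
  by (auto simp: agreeing_def card_gt_0_iff finite_labellings)

lemma agreeing_cong: "y \<in> agreeing I x \<Longrightarrow> J \<subseteq> I \<Longrightarrow> agreeing J y = agreeing J x"
  by (auto simp: agreeing_def)

lemma card_labellings: "card labellings = fact k * card E"
proof -
  have fib: "card {x \<in> labellings. x ` {..<k} = e} = fact k" if "e \<in> E" for e
  proof -
    have "{x \<in> labellings. x ` {..<k} = e} = {x \<in> {..<k} \<rightarrow>\<^sub>E e. inj_on x {..<k}}"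
    proof (intro set_eqI iffI)
      fix x assume "x \<in> {x \<in> labellings. x ` {..<k} = e}"
      then show "x \<in> {x \<in> {..<k} \<rightarrow>\<^sub>E e. inj_on x {..<k}}"
        using labelling_inj by (auto simp: labellings_def PiE_def)
    next
      fix x assume x: "x \<in> {x \<in> {..<k} \<rightarrow>\<^sub>E e. inj_on x {..<k}}"
      then have "x ` {..<k} = e"
        using that card_edge finite_edge
        by (intro card_subset_eq) (auto simp: card_image)
      then show "x \<in> {x \<in> labellings. x ` {..<k} = e}"
        using x that by (auto simp: labellings_def PiE_def)
    qed
    also have "card \<dots> = (\<Prod>i\<in>{0..<k}. k - i)"
      using that card_edge finite_edge by (subst card_inj_on_subset_funcset) auto
    also have "\<dots> = fact k"
      by (simp add: fact_prod_rev)
    finally show ?thesis .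
  qed
  have "card labellings = (\<Sum>e\<in>E. card {x \<in> labellings. x ` {..<k} = e})"
    using sum.group[OF finite_labellings finite_E, of "\<lambda>x. x ` {..<k}" "\<lambda>_. 1::nat"]
    by (simp add: labellings_def image_subset_iff)
  then show ?thesis using fib by simp
qed

lemma permute_labelling:
  assumes "\<pi> permutes {..<k}" "x \<in> labellings"
  shows "x \<circ> \<pi> \<in> labellings"
proof -
  have "(x \<circ> \<pi>) ` {..<k} = x ` {..<k}"
    using permutes_image[OF assms(1)] by (metis image_comp)
  moreover have "x \<circ> \<pi> \<in> extensional {..<k}"
    using assms permutes_not_in[OF assms(1)] by (fastforce simp: labellings_def extensional_def)
  ultimately show ?thesis
    using assms by (auto simp: labellings_def)
qed

lemma bij_permute_labellings:
  assumes "\<pi> permutes {..<k}"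
  shows "bij_betw (\<lambda>x. x \<circ> \<pi>) labellings labellings"
proof (rule bij_betwI[where g = "\<lambda>x. x \<circ> inv \<pi>"])
  show "(x \<circ> \<pi>) \<circ> inv \<pi> = x" for x :: "nat \<Rightarrow> 'a"
    using permutes_inv_o(1)[OF assms] by (simp add: comp_assoc)
  show "(x \<circ> inv \<pi>) \<circ> \<pi> = x" for x :: "nat \<Rightarrow> 'a"
    using permutes_inv_o(2)[OF assms] by (simp add: comp_assoc)
qed (use permute_labelling assms permutes_inv[OF assms] in auto)

lemma num_permute:
  assumes "\<pi> permutes {..<k}"
  shows "num I (x \<circ> \<pi>) = num (\<pi> ` I) x"
proof -
  have "bij_betw (\<lambda>y. y \<circ> \<pi>) {y \<in> labellings. \<forall>i\<in>\<pi> ` I. y i = x i}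
          {y \<in> labellings. \<forall>i\<in>I. y i = (x \<circ> \<pi>) i}"
    by (rule bij_betw_Collect[OF bij_permute_labellings[OF assms]]) simp
  then show ?thesis
    unfolding agreeing_def by (simp add: bij_betw_same_card)
qed

lemma entropy_permute:
  assumes "\<pi> permutes {..<k}"
  shows "entropy (\<pi> ` I) = entropy I"
proof -
  have "(\<Sum>x\<in>labellings. ln N - ln (num (\<pi> ` I) x))
      = (\<Sum>x\<in>labellings. ln N - ln (num I (x \<circ> \<pi>)))"
    by (simp add: num_permute[OF assms])
  also have "\<dots> = (\<Sum>x\<in>labellings. ln N - ln (num I x))"
    by (rule sum.reindex_bij_betw[OF bij_permute_labellings[OF assms]])
  finally show ?thesis by (simp add: entropy_def)
qed

text \<open>Permuting the positions maps labellings to labellings, and any two sets of positions of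
equal size are related by a permutation.\<close>
lemma entropy_card_eq:
  assumes "I \<subseteq> {..<k}" "J \<subseteq> {..<k}" "card I = card J"
  shows "entropy I = entropy J"
proof -
  have fin: "finite I" "finite J" using assms finite_subset by blast+
  obtain f where f: "bij_betw f I J"
    using finite_same_card_bij[OF fin assms(3)] by blast
  have "card ({..<k} - I) = card ({..<k} - J)"
    using assms fin by (simp add: card_Diff_subset)
  then obtain g where g: "bij_betw g ({..<k} - I) ({..<k} - J)"
    using finite_same_card_bij[of "{..<k} - I" "{..<k} - J"] by auto
  define \<pi> where "\<pi> x = (if x \<in> I then f x else if x < k then g x else x)" for x
  have "bij_betw \<pi> (I \<union> ({..<k} - I)) (J \<union> ({..<k} - J))"
  proof (rule bij_betw_combine)
    show "bij_betw \<pi> I J" 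
      using f by (subst bij_betw_cong[of _ _ f]) (auto simp: \<pi>_def)
    show "bij_betw \<pi> ({..<k} - I) ({..<k} - J)"
      using g by (subst bij_betw_cong[of _ _ g]) (auto simp: \<pi>_def)
  qed auto
  then have "bij_betw \<pi> {..<k} {..<k}"
    using assms by (simp add: Un_absorb1)
  then have "\<pi> permutes {..<k}"
    by (rule bij_imp_permutes) (use assms in \<open>auto simp: \<pi>_def\<close>)
  moreover have "\<pi> ` I = J"
    using bij_betw_imp_surj_on[OF f] by (auto simp: \<pi>_def)
  ultimately show ?thesis using entropy_permute by metis
qed

text \<open>Draw a labelling, forget it outside \<open>I\<close>, and complete it again uniformly: the result is uniform,
because agreement on \<open>I\<close> is an equivalence relation and the second draw is uniform in each class.\<close>
lemma resample:
  "(\<Sum>x\<in>labellings. (\<Sum>y\<in>agreeing I x. g y) / num I x) = (\<Sum>y\<in>labellings. g y)"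
proof -
  have "(\<Sum>x\<in>labellings. (\<Sum>y\<in>agreeing I x. g y) / num I x)
      = (\<Sum>x\<in>labellings. \<Sum>y\<in>{y \<in> labellings. \<forall>i\<in>I. y i = x i}. g y / num I x)"
    by (simp add: sum_divide_distrib agreeing_def)
  also have "\<dots> = (\<Sum>y\<in>labellings. \<Sum>x\<in>{x \<in> labellings. \<forall>i\<in>I. y i = x i}. g y / num I x)"
    by (rule sum.swap_restrict[OF finite_labellings finite_labellings])
  also have "\<dots> = (\<Sum>y\<in>labellings. \<Sum>x\<in>agreeing I y. g y / num I y)"
  proof (rule sum.cong[OF refl], rule sum.cong)
    fix x y assume "x \<in> agreeing I y"
    then show "g y / num I x = g y / num I y"
      using agreeing_cong[of x I y I] by simp
  qed (auto simp: agreeing_def)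
  also have "\<dots> = (\<Sum>y\<in>labellings. g y)"
  proof (rule sum.cong[OF refl])
    fix y assume "y \<in> labellings"
    then show "(\<Sum>x\<in>agreeing I y. g y / num I y) = g y"
      using num_pos[of y I] by (auto simp: card_gt_0_iff)
  qed
  finally show ?thesis .
qed

text \<open>Group the sum by the value \<open>v\<close> at position \<open>p\<close>.  The denominator is the size of the group, so each \<open>v\<close>
that is possible given \<open>I\<close> contributes the number of labellings that have \<open>v\<close> at \<open>p\<close> and agree
with \<open>x\<close> on \<open>C\<close>.\<close>
lemma sum_fibre_ratio:
  assumes "C \<subseteq> I" "x \<in> labellings"
  shows "(\<Sum>y\<in>agreeing I x. num (insert p C) y / num (insert p I) y)
       = real (card {z \<in> agreeing C x. z p \<in> (\<lambda>y. y p) ` agreeing I x})"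
proof -
  let ?V = "(\<lambda>y. y p) ` agreeing I x"
  have fib: "(\<Sum>y\<in>{y \<in> agreeing I x. y p = v}. num (insert p C) y / num (insert p I) y)
      = real (card {z \<in> agreeing C x. z p = v})" if "v \<in> ?V" for v
  proof -
    let ?F = "{y \<in> agreeing I x. y p = v}"
    have 1: "agreeing (insert p C) y = {z \<in> agreeing C x. z p = v}"
      and 2: "agreeing (insert p I) y = ?F" if "y \<in> ?F" for y
      using that assms(1) by (auto simp: agreeing_def)
    have "(\<Sum>y\<in>?F. num (insert p C) y / num (insert p I) y)
        = (\<Sum>y\<in>?F. real (card {z \<in> agreeing C x. z p = v}) / real (card ?F))"
      by (rule sum.cong[OF refl]) (simp only: 1 2)
    moreover have "card ?F \<noteq> 0" using that by (auto simp: card_eq_0_iff)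
    ultimately show ?thesis by simp
  qed
  have "(\<Sum>y\<in>agreeing I x. num (insert p C) y / num (insert p I) y)
      = (\<Sum>v\<in>?V. \<Sum>y\<in>{y \<in> agreeing I x. y p = v}. num (insert p C) y / num (insert p I) y)"
    by (rule sum.image_gen) simp
  also have "\<dots> = (\<Sum>v\<in>?V. real (card {z \<in> agreeing C x. z p = v}))"
    by (rule sum.cong[OF refl fib])
  also have "\<dots> = (\<Sum>v\<in>?V. \<Sum>z\<in>{z \<in> {z \<in> agreeing C x. z p \<in> ?V}. z p = v}. 1)"
    by (intro sum.cong) (auto intro!: arg_cong[where f = card])
  also have "\<dots> = real (card {z \<in> agreeing C x. z p \<in> ?V})"
    by (subst sum.group) auto
  finally show ?thesis .
qed

text \<open>One half of Gibbs' inequality for the mixture of two resampled vertices; \<open>a\<close> is the weight of the half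
that resamples position \<open>p\<close> given \<open>I\<close>.  The reference distribution resamples the position given
only \<open>C\<close>, and the sum on the right is the mass that it gives to the vertices that are possible at \<open>p\<close>
given \<open>I\<close>.\<close>
lemma entropy_gap_le:
  assumes "C \<subseteq> I" "0 < a"
  shows "a * N * ((entropy (insert p I) - entropy I) - ln a - (entropy (insert p C) - entropy C))
     \<le> (\<Sum>x\<in>labellings. real (card {z \<in> agreeing C x. z p \<in> (\<lambda>y. y p) ` agreeing I x}) / num C x)
        - a * N"
proof (cases "labellings = {}")
  case False
  then have N: "N > 0" using finite_labellings by (simp add: card_gt_0_iff)
  (* The ratio of the reference probability of the vertex x p to its weight in the mixture,
     which is a times its probability given I. *)
  define t where "t x = num (insert p C) x * num I x / (a * num C x * num (insert p I) x)" for x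
  have t_pos: "0 < t x" if "x \<in> labellings" for x
    using assms(2) num_pos[OF that] by (simp add: t_def)
  have ln_t: "ln (t x) = ln (num (insert p C) x) + ln (num I x) - (ln a + ln (num C x) + ln (num (insert p I) x))"
    if "x \<in> labellings" for x
    using num_pos[OF that] assms(2)
    by (simp add: t_def ln_div ln_mult less_imp_neq[symmetric])
  have ent: "N * entropy J = (\<Sum>x\<in>labellings. ln N - ln (num J x))" for J
    using N by (simp add: entropy_def)
  (* Gibbs' inequality in the form ln t \<le> t - 1. *)
  have "a * N * ((entropy (insert p I) - entropy I) - ln a - (entropy (insert p C) - entropy C))
      = a * ((N * entropy (insert p I) - N * entropy I) - N * ln a - (N * entropy (insert p C) - N * entropy C))"
    by (simp add: algebra_simps)
  also have "\<dots> = a * (\<Sum>x\<in>labellings. ln (t x))"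
    unfolding ent using ln_t by (simp add: sum.distrib sum_subtractf)
  also have "\<dots> \<le> a * (\<Sum>x\<in>labellings. t x - 1)"
    using assms(2) t_pos ln_le_minus_one by (intro mult_left_mono sum_mono) auto
  also have "\<dots> = (\<Sum>x\<in>labellings. a * t x) - a * N"
    by (simp add: sum_subtractf sum_distrib_left algebra_simps)
  also have "(\<Sum>x\<in>labellings. a * t x)
      = (\<Sum>x\<in>labellings. (\<Sum>y\<in>agreeing I x. a * t y) / num I x)"
    by (rule resample[symmetric])
  also have "\<dots> = (\<Sum>x\<in>labellings. real (card {z \<in> agreeing C x. z p \<in> (\<lambda>y. y p) ` agreeing I x}) / num C x)"
  proof (rule sum.cong[OF refl])
    fix x assume x: "x \<in> labellings"
    have "a * t y = num (insert p C) y / num (insert p I) y * (num I x / num C x)"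
      if "y \<in> agreeing I x" for y
      using that agreeing_cong[OF that] assms by (simp add: t_def)
    then have "(\<Sum>y\<in>agreeing I x. a * t y)
      = (\<Sum>y\<in>agreeing I x. num (insert p C) y / num (insert p I) y) * (num I x / num C x)"
      unfolding sum_distrib_right by (rule sum.cong[OF refl])
    then show "(\<Sum>y\<in>agreeing I x. a * t y) / num I x =
       real (card {z \<in> agreeing C x. z p \<in> (\<lambda>y. y p) ` agreeing I x}) / num C x"
      unfolding sum_fibre_ratio[OF assms(1) x] using num_pos[OF x, of I]
      by (simp only:) simp
  qed
  finally show ?thesis .
qed simp

text \<open>The only place where the absence of entangled triples enters.  Suppose that \<open>y\<close> and \<open>z\<close> put the same vertex \<open>v\<close> at
\<open>p\<close> and \<open>q\<close>.  Their edges cover the edge of \<open>x\<close>, because \<open>I \<union> J\<close> contains all positions, and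
\<open>v\<close> is not in the edge of \<open>x\<close>, because \<open>y\<close> and \<open>z\<close> are injective.\<close>
lemma disjoint_extensions:
  assumes "\<not> entangled E" "x \<in> labellings"
    and "I \<union> J = {..<k}" "p < k" "q < k" "p \<notin> I" "q \<notin> J"
  shows "(\<lambda>y. y p) ` agreeing I x \<inter> (\<lambda>y. y q) ` agreeing J x = {}"
proof (rule ccontr)
  assume "\<not> ?thesis"
  then obtain y z where y: "y \<in> agreeing I x" and z: "z \<in> agreeing J x" and yz: "y p = z q"
    by auto
  have yE: "y \<in> labellings" and zE: "z \<in> labellings" using y z by (auto simp: agreeing_def)
  have "x ` {..<k} \<subseteq> y ` {..<k} \<union> z ` {..<k}"
  proof
    fix u assume "u \<in> x ` {..<k}"
    then obtain l where l: "l < k" "u = x l" by auto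
    then have "l \<in> I \<or> l \<in> J" using assms(3) by blast
    then have "u = y l \<or> u = z l" using y z l by (auto simp: agreeing_def)
    then show "u \<in> y ` {..<k} \<union> z ` {..<k}" using l by blast
  qed
  moreover have "y p \<in> y ` {..<k} \<inter> z ` {..<k}"
    using yz assms(4,5) by (metis IntI imageI lessThan_iff)
  moreover have "y p \<notin> x ` {..<k}"
  proof
    assume "y p \<in> x ` {..<k}"
    then obtain l where l: "l < k" "y p = x l" by auto
    then consider "l \<in> I" | "l \<in> J" using assms(3) by blast
    then show False
    proof cases
      case 1
      then have "y p = y l" using y l by (auto simp: agreeing_def)
      then show False using labelling_inj[OF yE] l 1 assms by (auto dest: inj_onD)
    next
      case 2
      then have "z q = z l" using z l yz by (auto simp: agreeing_def)
      then show False using labelling_inj[OF zE] l 2 assms by (auto dest: inj_onD)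
    qed
  qed
  ultimately show False
    using assms(1,2) yE zE unfolding entangled_def labellings_def by blast
qed

lemma card_extensions_le:
  assumes "\<not> entangled E" "x \<in> labellings"
    and "I \<union> J = {..<k}" "p < k" "q < k" "p \<notin> I" "q \<notin> J" "C \<subseteq> I \<inter> J"
  shows "card {z \<in> agreeing C x. z p \<in> (\<lambda>y. y p) ` agreeing I x}
       + card {z \<in> agreeing C x. z q \<in> (\<lambda>y. y q) ` agreeing J x} \<le> card (agreeing C x)"
proof -
  let ?V = "(\<lambda>y. y p) ` agreeing I x" and ?W = "(\<lambda>y. y q) ` agreeing J x"
  let ?\<pi> = "transpose p q"
  have perm: "?\<pi> permutes {..<k}" using assms by (intro permutes_swap_id) auto
  have pq: "i \<noteq> p" "i \<noteq> q" if "i \<in> C" for i using that assms by auto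
  (* Given C, the positions p and q are exchangeable. *)
  have "card {z \<in> agreeing C x. z q \<in> ?W} \<le> card {z \<in> agreeing C x. z p \<in> ?W}"
  proof (rule card_inj_on_le[where f = "\<lambda>z. z \<circ> ?\<pi>"])
    show "inj_on (\<lambda>z. z \<circ> ?\<pi>) {z \<in> agreeing C x. z q \<in> ?W}"
      using bij_betw_imp_inj_on[OF bij_permute_labellings[OF perm]]
      by (rule inj_on_subset) (auto simp: agreeing_def)
    show "(\<lambda>z. z \<circ> ?\<pi>) ` {z \<in> agreeing C x. z q \<in> ?W} \<subseteq> {z \<in> agreeing C x. z p \<in> ?W}"
      using pq permute_labelling[OF perm] by (auto simp: agreeing_def transpose_def)
  qed simp
  then have "card {z \<in> agreeing C x. z p \<in> ?V} + card {z \<in> agreeing C x. z q \<in> ?W}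
      \<le> card {z \<in> agreeing C x. z p \<in> ?V} + card {z \<in> agreeing C x. z p \<in> ?W}"
    by simp
  also have "\<dots> = card ({z \<in> agreeing C x. z p \<in> ?V} \<union> {z \<in> agreeing C x. z p \<in> ?W})"
    using disjoint_extensions[OF assms(1-7)] by (intro card_Un_disjoint[symmetric]) auto
  also have "\<dots> \<le> card (agreeing C x)"
    by (rule card_mono) auto
  finally show ?thesis .
qed

text \<open>The exponential of the entropy of one vertex given \<open>k - i\<close> others: the effective number of choices for
a vertex when it and \<open>i - 1\<close> further vertices are unknown.  In the complete balanced \<open>k\<close>-partite
\<open>k\<close>-graph on \<open>n\<close> vertices it equals \<open>i * n / k\<close>.\<close>
definition cond_size :: "nat \<Rightarrow> real" where
  "cond_size i = exp (entropy {..<Suc (k - i)} - entropy {..<k - i})"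

lemma cond_size_eq:
  assumes "I \<subseteq> {..<k}" "p < k" "p \<notin> I" "card I = k - i" "0 < i" "i \<le> k"
  shows "entropy (insert p I) - entropy I = ln (cond_size i)"
proof -
  have "finite I" using assms(1) finite_subset by blast
  then have "entropy (insert p I) = entropy {..<Suc (k - i)}"
    using assms by (intro entropy_card_eq) auto
  moreover have "entropy I = entropy {..<k - i}"
    using assms by (intro entropy_card_eq) auto
  ultimately show ?thesis by (simp add: cond_size_def)
qed

text \<open>Add the bounds of \<open>entropy_gap_le\<close> for the two halves of the mixture; by disjointness the reference
masses add up to at most 1.\<close>
lemma cond_size_superadditive:
  assumes "\<not> entangled E" "E \<noteq> {}" "0 < i" "0 < j" "i + j \<le> k"
  shows "cond_size i + cond_size j \<le> cond_size (i + j)"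
proof -
  have N: "N > 0"
    using card_labellings assms(2) finite_E by (simp add: card_gt_0_iff)
  let ?y = cond_size
  have y_pos: "0 < ?y l" for l by (simp add: cond_size_def)
  define C where "C = {..<k - (i + j)}"
  define I where "I = {..<k - i}"
  define J where "J = C \<union> {k - i..<k}"
  define p q where "p = k - i" and "q = k - (i + j)"
  have sub: "C \<subseteq> I" "C \<subseteq> J" "C \<subseteq> I \<inter> J" "I \<union> J = {..<k}" "p < k" "q < k" "p \<notin> I" "q \<notin> J" "q \<notin> C" "p \<notin> C"
    using assms by (auto simp: C_def I_def J_def p_def q_def)
  have card: "card C = k - (i + j)" "card I = k - i"
    by (simp_all add: C_def I_def)
  have cardJ: "card J = k - j"
    unfolding J_def C_def using assms by (subst card_Un_disjoint) auto
  define s where "s = ?y i + ?y j"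
  (* These weights maximise the entropy of the mixture, and both halves then contribute ln s. *)
  define a b where "a = ?y i / s" and "b = ?y j / s"
  have s: "s > 0" using y_pos by (simp add: s_def add_pos_pos)
  have ab: "0 < a" "0 < b" "a + b = 1"
    using s y_pos by (simp_all add: a_def b_def add_divide_distrib [symmetric]) (simp add: s_def)
  have lna: "ln (?y i) - ln a = ln s" "ln (?y j) - ln b = ln s"
    using s y_pos by (simp_all add: a_def b_def ln_div less_imp_neq[symmetric])
  let ?K = "\<lambda>I p x. real (card {z \<in> agreeing C x. z p \<in> (\<lambda>y. y p) ` agreeing I x})"
  have ent: "entropy (insert p I) - entropy I = ln (?y i)"
    "entropy (insert q J) - entropy J = ln (?y j)"
    "entropy (insert p C) - entropy C = ln (?y (i + j))"
    "entropy (insert q C) - entropy C = ln (?y (i + j))"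
    using sub card cardJ assms by (auto intro!: cond_size_eq)
  have A: "a * N * (ln s - ln (?y (i + j))) \<le> (\<Sum>x\<in>labellings. ?K I p x / num C x) - a * N"
    using entropy_gap_le[OF sub(1) ab(1), of p] lna
    by (simp add: ent)
  have B: "b * N * (ln s - ln (?y (i + j))) \<le> (\<Sum>x\<in>labellings. ?K J q x / num C x) - b * N"
    using entropy_gap_le[OF sub(2) ab(2), of q] lna
    by (simp add: ent)
  have "N * (ln s - ln (?y (i + j))) = (a + b) * N * (ln s - ln (?y (i + j)))"
    using ab by simp
  also have "\<dots> \<le> (\<Sum>x\<in>labellings. ?K I p x / num C x) + (\<Sum>x\<in>labellings. ?K J q x / num C x) - (a + b) * N"
    using A B by (simp add: algebra_simps)
  also have "\<dots> = (\<Sum>x\<in>labellings. (?K I p x + ?K J q x) / num C x) - N"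
    using ab by (simp add: sum.distrib add_divide_distrib)
  also have "\<dots> \<le> (\<Sum>x\<in>labellings. 1) - N"
  proof -
    have "(?K I p x + ?K J q x) / num C x \<le> 1" if "x \<in> labellings" for x
      using card_extensions_le[OF assms(1) that sub(4-8) sub(3)] num_pos[OF that, of C]
      by (simp add: divide_le_eq_1 flip: of_nat_add)
    then show ?thesis by (intro diff_right_mono sum_mono) auto
  qed
  finally have "N * (ln s - ln (?y (i + j))) \<le> 0" by simp
  then have "ln s \<le> ln (?y (i + j))"
    using N by (simp add: mult_le_0_iff)
  then show ?thesis
    using s y_pos by (simp add: s_def)
qed

text \<open>A random vertex takes at most \<open>card V\<close> values, so its entropy is at most \<open>ln (card V)\<close>; the proof is again
Gibbs' inequality, with the uniform distribution on \<open>V\<close> as reference.\<close>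
lemma cond_size_top_le:
  assumes "finite V" "\<Union>E \<subseteq> V" "E \<noteq> {}"
  shows "cond_size k \<le> real (card V)"
proof -
  have N: "N > 0"
    using card_labellings assms finite_E by (simp add: card_gt_0_iff)
  obtain e where "e \<in> E" using assms by auto
  then have V: "card V > 0"
    using card_edge[of e] k_pos assms by (auto simp: card_gt_0_iff)
  have num0: "num {} x = N" for x by (simp add: agreeing_def)
  have "N * (ln (cond_size k) - ln (card V))
      = (\<Sum>x\<in>labellings. ln (N / (num {0} x * card V)))"
  proof -
    have "ln (N / (num {0} x * card V)) = ln N - ln (num {0} x) - ln (card V)"
      if "x \<in> labellings" for x
      using N V num_pos[OF that] by (simp add: ln_div ln_mult less_imp_neq[symmetric])
    then have "(\<Sum>x\<in>labellings. ln (N / (num {0} x * card V)))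
        = (\<Sum>x\<in>labellings. ln N - ln (num {0} x)) - N * ln (card V)"
      by (simp add: sum_subtractf)
    moreover have "N * ln (cond_size k) = (\<Sum>x\<in>labellings. ln N - ln (num {0} x))"
      using N by (simp add: cond_size_def entropy_def num0 lessThan_Suc)
    ultimately show ?thesis by (simp add: right_diff_distrib)
  qed
  also have "\<dots> \<le> (\<Sum>x\<in>labellings. N / (num {0} x * card V) - 1)"
    using N V num_pos by (intro sum_mono ln_le_minus_one) simp
  also have "\<dots> = (N / card V) * (\<Sum>x\<in>labellings. 1 / num {0} x) - N"
    by (simp add: sum_subtractf sum_distrib_left mult.commute)
  also have "(\<Sum>x\<in>labellings. 1 / num {0} x) \<le> real (card V)"
  proof -
    have "(\<Sum>x\<in>labellings. 1 / num {0} x)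
        = (\<Sum>v\<in>(\<lambda>x. x 0) ` labellings. \<Sum>x\<in>{x \<in> labellings. x 0 = v}. 1 / num {0} x)"
      by (rule sum.image_gen[OF finite_labellings])
    also have "\<dots> = (\<Sum>v\<in>(\<lambda>x. x 0) ` labellings. 1)"
    proof (rule sum.cong[OF refl])
      fix v assume v: "v \<in> (\<lambda>x. x 0) ` labellings"
      let ?F = "{x \<in> labellings. x 0 = v}"
      have "agreeing {0} x = ?F" if "x \<in> ?F" for x
        using that by (auto simp: agreeing_def)
      then have "(\<Sum>x\<in>?F. 1 / num {0} x) = (\<Sum>x\<in>?F. 1 / real (card ?F))"
        by (intro sum.cong) auto
      moreover have "card ?F \<noteq> 0" using v finite_labellings by auto
      ultimately show "(\<Sum>x\<in>?F. 1 / num {0} x) = 1" by simp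
    qed
    also have "\<dots> = real (card ((\<lambda>x. x 0) ` labellings))" by simp
    also have "(\<lambda>x. x 0) ` labellings \<subseteq> V"
      using assms(2) k_pos by (auto simp: labellings_def)
    then have "real (card ((\<lambda>x. x 0) ` labellings)) \<le> real (card V)"
      using card_mono[OF assms(1)] by simp
    finally show ?thesis .
  qed
  then have "(N / card V) * (\<Sum>x\<in>labellings. 1 / num {0} x) - N \<le> (N / card V) * card V - N"
    using N V by (intro diff_right_mono mult_left_mono) auto
  also have "\<dots> = 0" using V by simp
  finally have "ln (cond_size k) \<le> ln (card V)" using N by (simp add: mult_le_0_iff)
  moreover have "0 < cond_size k" by (simp add: cond_size_def)
  ultimately show ?thesis using V by simp
qed

text \<open>The chain rule for the entropy of a random labelling.\<close>
lemma sum_ln_cond_size: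
  assumes "E \<noteq> {}"
  shows "(\<Sum>i=1..k. ln (cond_size i)) = ln N"
proof -
  have N: "N > 0"
    using card_labellings assms finite_E by (simp add: card_gt_0_iff)
  have "(\<Sum>i=1..k. ln (cond_size i)) = (\<Sum>l<k. entropy {..<Suc l} - entropy {..<l})"
    by (rule sum.reindex_bij_witness[where i = "\<lambda>l. k - l" and j = "\<lambda>i. k - i"])
      (auto simp: cond_size_def)
  also have "\<dots> = entropy {..<k} - entropy {..<0}"
    by (rule sum_lessThan_telescope)
  also have "entropy {..<0} = 0"
    by (simp add: entropy_def agreeing_def)
  also have "entropy {..<k} = ln N"
  proof -
    have "agreeing {..<k} x = {x}" if "x \<in> labellings" for x
      using that by (auto simp: agreeing_def labellings_def intro!: extensionalityI)
    then show ?thesis using N by (simp add: entropy_def)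
  qed
  finally show ?thesis by simp
qed

end

section \<open>Families without entangled triples\<close>

text \<open>Let \<open>s m\<close> be the sum up to \<open>m\<close>.  Adding the induction hypotheses \<open>s l \<le> y l\<close> for \<open>l < n\<close> and
exchanging the order of summation bounds \<open>n * s (n - 1)\<close> by \<open>2 * (\<Sum>i=1..n-1. y i)\<close>, and pairing
\<open>i\<close> with \<open>n - i\<close> bounds this by \<open>(n - 1) * y n\<close>.\<close>
lemma superadditive_sum_le:
  fixes y :: "nat \<Rightarrow> real"
  assumes super: "\<And>i j. 0 < i \<Longrightarrow> 0 < j \<Longrightarrow> i + j \<le> n \<Longrightarrow> y i + y j \<le> y (i + j)"
    and "0 < n"
  shows "(\<Sum>i=1..n. y i / real i) \<le> y n"
  using assms
proof (induction n rule: less_induct)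
  case (less n)
  define s where "s m = (\<Sum>i=1..m. y i / real i)" for m
  have s_Suc: "real (Suc m) * s (Suc m) = real (Suc m) * s m + y (Suc m)" for m
    by (simp add: s_def field_simps)
  obtain m where n: "n = Suc m" using less.prems by (cases n) auto
  have double: "(\<Sum>l=1..m. s l) = real n * s m - (\<Sum>i=1..m. y i)"
    unfolding n
  proof (induction m)
    case (Suc m)
    then show ?case using s_Suc[of m] by (simp add: algebra_simps)
  qed (simp add: s_def)
  have "(\<Sum>l=1..m. s l) \<le> (\<Sum>l=1..m. y l)"
    using less n by (intro sum_mono) (auto simp: s_def)
  then have "real n * s m \<le> (\<Sum>i=1..m. y i) + (\<Sum>i=1..m. y i)"
    using double by simp
  also have "(\<Sum>i=1..m. y i) + (\<Sum>i=1..m. y i) = (\<Sum>i=1..m. y i + y (n - i))"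
  proof -
    have "(\<Sum>i=1..m. y i) = (\<Sum>i=1..m. y (n - i))"
      by (rule sum.reindex_bij_witness[where i = "\<lambda>l. n - l" and j = "\<lambda>i. n - i"]) (auto simp: n)
    then show ?thesis by (simp add: sum.distrib)
  qed
  also have "\<dots> \<le> (\<Sum>i=1..m. y n)"
  proof (rule sum_mono)
    fix i assume "i \<in> {1..m}"
    then show "y i + y (n - i) \<le> y n" using less.prems(1)[of i "n - i"] n by auto
  qed
  finally have "real n * s m \<le> real m * y n" by simp
  then have "real n * s n \<le> real n * y n"
    using s_Suc[of m] unfolding n by (simp add: algebra_simps)
  then show ?case using \<open>0 < n\<close> by (simp add: s_def)
qed

text \<open>The inequality of arithmetic and geometric means, applied to the numbers \<open>k * y\<^sub>i / (i * n)\<close>.  Their sum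
is at most \<open>k\<close>, so their product \<open>k ^ k * card E / n ^ k\<close> is at most 1.\<close>
theorem not_entangled_card_le:
  fixes E :: "'a set set"
  assumes "0 < k" "finite V" "\<And>e. e \<in> E \<Longrightarrow> e \<subseteq> V \<and> card e = k" "\<not> entangled E"
  shows "real (card E) \<le> (real (card V) / real k) ^ k"
proof (cases "E = {}")
  case False
  have "finite E"
    using assms(2,3) by (intro finite_subset[of E "Pow V"]) auto
  then interpret uniform_family k E
    using assms by unfold_locales auto
  let ?y = cond_size and ?n = "real (card V)"
  have N: "N > 0"
    using card_labellings False finite_E by (simp add: card_gt_0_iff)
  have y_pos: "0 < ?y l" for l by (simp add: cond_size_def)
  have yk: "?y k \<le> ?n"
    using cond_size_top_le[of V] assms False by blast
  then have n: "?n > 0" using y_pos[of k] by linarith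
  have "(\<Sum>i=1..k. ?y i / real i) \<le> ?n"
    using superadditive_sum_le[of k ?y] cond_size_superadditive[OF assms(4) False] assms(1) yk
    by fastforce
  then have "(real k / ?n) * (\<Sum>i=1..k. ?y i / real i) \<le> (real k / ?n) * ?n"
    by (intro mult_left_mono) auto
  then have S: "(\<Sum>i=1..k. real k * ?y i / (real i * ?n)) \<le> real k"
    using n by (simp add: sum_distrib_left mult.commute)
  have "ln (fact k :: real) = (\<Sum>i=1..k. ln (real i))"
    unfolding fact_prod of_nat_prod by (rule ln_prod) auto
  then have "ln N - ln (fact k) + real k * (ln k - ln ?n) = (\<Sum>i=1..k. ln (?y i) - ln i + (ln k - ln ?n))"
    using sum_ln_cond_size[OF False]
    by (simp add: sum.distrib sum_subtractf)
  also have "\<dots> = (\<Sum>i=1..k. ln (real k * ?y i / (real i * ?n)))"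
    using n y_pos assms(1) by (intro sum.cong) (auto simp: ln_div ln_mult less_imp_neq[symmetric])
  also have "\<dots> \<le> (\<Sum>i=1..k. real k * ?y i / (real i * ?n) - 1)"
    using n y_pos assms(1) by (intro sum_mono ln_le_minus_one) auto
  also have "\<dots> \<le> 0" using S by (simp add: sum_subtractf)
  finally have *: "ln N - ln (fact k) + real k * (ln k - ln ?n) \<le> 0" .
  have "ln (card E) = ln N - ln (fact k)"
    using False finite_E by (simp add: card_labellings ln_mult)
  also have "\<dots> \<le> real k * ln (?n / k)"
    using * n assms(1) by (simp add: ln_div algebra_simps)
  also have "\<dots> = ln ((?n / k) ^ k)"
    using n assms(1) by (simp add: ln_realpow)
  finally show ?thesis
    using n assms(1) False finite_E by (subst (asm) ln_le_cancel_iff) (auto simp: card_gt_0_iff)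
qed (use assms in simp)

section \<open>Tents as triples of edges\<close>
definition contains_tent :: "'a set set \<Rightarrow> bool" where
  "contains_tent E \<longleftrightarrow> (\<exists>e\<in>E. \<exists>f\<in>E. \<exists>g\<in>E. \<exists>v. e \<subseteq> f \<union> g \<and> f \<inter> g = {v} \<and> v \<notin> e)"

text \<open>The inequality between the two intersections only makes the parts decreasing, as the
definition of a partition demands.\<close>
lemma is_tent_of_edges:
  fixes e f g :: "'a set"
  assumes "0 < k" "card e = k" "card f = k" "card g = k"
    and sub: "e \<subseteq> f \<union> g" and meet: "f \<inter> g = {v}" and "v \<notin> e"
    and le: "card (g \<inter> e) \<le> card (f \<inter> e)"
  shows "\<exists>p. is_partition k p \<and> length p = 2 \<and>
           is_tent p \<lparr>verts = e \<union> f \<union> g, edges = {e, f, g}\<rparr>"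
proof -
  let ?p = "[card (f \<inter> e), card (g \<inter> e)]"
  have fin: "finite e" "finite f" "finite g"
    using assms(1-4) card.infinite by fastforce+
  have "card (g \<inter> e) > 0"
  proof (rule ccontr)
    assume "\<not> ?thesis"
    then have "e \<subseteq> f" using sub fin by auto
    (* Edges of the same size cannot be properly contained in each other. *)
    then have "e = f" using assms fin by (intro card_subset_eq) auto
    then show False using meet \<open>v \<notin> e\<close> by auto
  qed
  moreover have "card (f \<inter> e) + card (g \<inter> e) = k"
  proof -
    have "(f \<inter> e) \<union> (g \<inter> e) = e" "(f \<inter> e) \<inter> (g \<inter> e) = {}"
      using sub meet \<open>v \<notin> e\<close> by auto
    then show ?thesis
      using card_Un_disjoint[of "f \<inter> e" "g \<inter> e"] fin assms(2) by auto
  qed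
  ultimately have p: "is_partition k ?p" and sum: "sum_list ?p = k"
    using le by (auto simp: is_partition_def)
  define d where "d i = (if i = 0 then f else g)" for i :: nat
  have two: "{..<length ?p} = {0, 1}" by auto
  let ?T = "\<lparr>verts = e \<union> f \<union> g, edges = {e, f, g}\<rparr>"
  have "is_tent ?p ?T"
    unfolding is_tent_def sum
  proof (intro conjI exI[of _ v] exI[of _ e] exI[of _ d])
    show "is_partition k ?p" by (rule p)
    show "edges ?T = insert e (d ` {..<length ?p})"
      unfolding two by (simp add: d_def insert_commute)
    show "verts ?T = \<Union> (edges ?T)" by auto
    show "\<forall>a\<in>edges ?T. card a = k" using assms by simp
    show "v \<notin> e" by fact
    show "\<forall>i<length ?p. v \<in> d i \<and> card (d i \<inter> e) = ?p ! i"
      using meet by (auto simp: d_def less_Suc_eq)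
    show "\<forall>i<length ?p. \<forall>j<length ?p. i \<noteq> j \<longrightarrow> d i \<inter> d j = {v}"
      using meet by (auto simp: d_def less_Suc_eq)
  qed simp
  then show ?thesis using p by (intro exI[of _ ?p]) simp
qed

lemma free_imp_not_contains_tent:
  fixes G :: "nat hypergraph"
  assumes "0 < k" "kgraph k G" "free_of (two_part_tents k) G"
  shows "\<not> contains_tent (edges G)"
proof
  assume "contains_tent (edges G)"
  then obtain e f g v where efg: "e \<in> edges G" "f \<in> edges G" "g \<in> edges G"
    and tent: "e \<subseteq> f \<union> g" "f \<inter> g = {v}" "v \<notin> e"
    unfolding contains_tent_def by blast
  let ?H = "\<lambda>f g. \<lparr>verts = e \<union> f \<union> g, edges = {e, f, g}\<rparr>"
  have no_tent: "?H f g \<notin> two_part_tents k" if "f \<in> edges G" "g \<in> edges G" for f g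
  proof
    assume "?H f g \<in> two_part_tents k"
    moreover have "subgraph (?H f g) G"
      using that efg(1) assms(2) by (auto simp: subgraph_def kgraph_def)
    moreover have "isomorphic (?H f g) (?H f g)"
      unfolding isomorphic_def by (rule exI[of _ id]) simp
    ultimately show False using assms(3) unfolding free_of_def by blast
  qed
  have card: "card e = k" "card f = k" "card g = k"
    using efg assms(2) by (auto simp: kgraph_def)
  consider "card (g \<inter> e) \<le> card (f \<inter> e)" | "card (f \<inter> e) \<le> card (g \<inter> e)" by linarith
  then show False
  proof cases
    case 1
    then have "?H f g \<in> two_part_tents k"
      using is_tent_of_edges[OF assms(1) card tent] by (simp add: two_part_tents_def)
    then show False using no_tent efg by blast
  next
    case 2
    have "e \<subseteq> g \<union> f" "g \<inter> f = {v}" using tent by auto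
    then have "?H g f \<in> two_part_tents k"
      using is_tent_of_edges[OF assms(1) card(1,3,2) _ _ tent(3) 2]
      by (simp add: two_part_tents_def)
    then show False using no_tent efg by blast
  qed
qed

text \<open>A tent is an entangled triple: the parts of the base add up to its size, so the two other edges cover it.
An isomorphism carries this over to the copy of the tent.\<close>
lemma not_entangled_imp_free:
  assumes "0 < k" "\<not> entangled (edges G)"
  shows "free_of (two_part_tents k) G"
  unfolding free_of_def
proof
  assume "\<exists>F\<in>two_part_tents k. \<exists>H. subgraph H G \<and> isomorphic F H"
  then obtain T :: "nat hypergraph" and H p where sub: "subgraph H G" and iso: "isomorphic T H"
    and p: "is_partition k p" "length p = 2" and T: "is_tent p T"
    unfolding two_part_tents_def by blast
  have k: "sum_list p = k" using p by (simp add: is_partition_def)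
  have two: "{..<length p} = {0, 1}" using p by auto
  obtain v b d where eT: "edges T = insert b (d ` {0, 1})" and vT: "verts T = \<Union> (edges T)"
    and cT: "\<forall>a\<in>edges T. card a = k" and v: "v \<notin> b"
    and d: "\<forall>i<2. v \<in> d i \<and> card (d i \<inter> b) = p ! i"
    and dd: "\<forall>i<2. \<forall>j<2. i \<noteq> j \<longrightarrow> d i \<inter> d j = {v}"
    using T unfolding is_tent_def k two unfolding p(2) by auto
  obtain \<phi> where \<phi>: "bij_betw \<phi> (verts T) (verts H)" "edges H = (`) \<phi> ` edges T"
    using iso unfolding isomorphic_def by blast
  have b: "b \<in> edges T" "d 0 \<in> edges T" "d 1 \<in> edges T" using eT by auto
  have cb: "card b = k" using b cT by blast
  then have fb: "finite b" using assms(1) card.infinite by fastforce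
  have "p ! 0 + p ! 1 = k"
    using p by (cases p; cases "tl p") (auto simp: is_partition_def)
  then have "card (d 0 \<inter> b) + card (d 1 \<inter> b) = k" using d by auto
  moreover have "d 0 \<inter> d 1 = {v}" using dd by auto
  then have "(d 0 \<inter> b) \<inter> (d 1 \<inter> b) = {}" using v by auto
  ultimately have "card ((d 0 \<inter> b) \<union> (d 1 \<inter> b)) = card b"
    using fb cb by (subst card_Un_disjoint) auto
  then have "(d 0 \<inter> b) \<union> (d 1 \<inter> b) = b"
    using fb by (intro card_subset_eq) auto
  then have "b \<subseteq> d 0 \<union> d 1" by blast
  then have 1: "\<phi> ` b \<subseteq> \<phi> ` d 0 \<union> \<phi> ` d 1" by blast
  have "v \<in> d 0" "v \<in> d 1" using d by auto
  moreover have "\<phi> v \<notin> \<phi> ` b"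
    using bij_betw_imp_inj_on[OF \<phi>(1)] v b \<open>v \<in> d 0\<close> vT
    by (subst inj_on_image_mem_iff[where B = "verts T"]) auto
  ultimately have 2: "\<not> \<phi> ` d 0 \<inter> \<phi> ` d 1 \<subseteq> \<phi> ` b" by blast
  have "edges H \<subseteq> edges G" using sub by (simp add: subgraph_def)
  then have "\<phi> ` b \<in> edges G" "\<phi> ` d 0 \<in> edges G" "\<phi> ` d 1 \<in> edges G"
    using b \<phi>(2) by auto
  then have "entangled (edges G)"
    unfolding entangled_def using 1 2 by (intro bexI conjI)
  with assms(2) show False ..
qed

lemma card_edges_containing_le:
  assumes "finite V" "\<And>e. e \<in> E \<Longrightarrow> e \<subseteq> V \<and> card e = k" "finite S"
  shows "card {e \<in> E. S \<subseteq> e} \<le> card V ^ (k - card S)"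
proof -
  have fin: "finite e" if "e \<in> E" for e using assms that finite_subset by blast
  have "card {e \<in> E. S \<subseteq> e} \<le> card {A. A \<subseteq> V \<and> card A = k - card S}"
  proof (rule card_inj_on_le[where f = "\<lambda>e. e - S"])
    show "inj_on (\<lambda>e. e - S) {e \<in> E. S \<subseteq> e}"
      by (rule inj_onI) blast
    show "(\<lambda>e. e - S) ` {e \<in> E. S \<subseteq> e} \<subseteq> {A. A \<subseteq> V \<and> card A = k - card S}"
      using assms by (auto simp: card_Diff_subset)
  qed (use assms in simp)
  also have "\<dots> = card V choose (k - card S)"
    using assms(1) by (rule n_subsets)
  also have "\<dots> \<le> (card V choose (k - card S)) * fact (k - card S)"
    by simp
  also have "\<dots> \<le> card V ^ (k - card S)" by (rule binomial_fact_pow)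
  finally show ?thesis .
qed

section \<open>Removing the edges that contain a light set\<close>

text \<open>The threshold is tuned to \<open>avoiding_edge\<close>: a single vertex outside \<open>S\<close> lies in at most
\<open>n ^ (k - card S - 1)\<close> of the edges through \<open>S\<close>, and at most \<open>2 * k\<close> vertices have to be avoided.\<close>
definition light :: "nat \<Rightarrow> nat \<Rightarrow> 'a set set \<Rightarrow> 'a set \<Rightarrow> bool" where
  "light k n E S \<longleftrightarrow> 2 \<le> card S \<and> card S < k \<and>
     card {e \<in> E. S \<subseteq> e} \<le> 2 * k * n ^ (k - card S - 1)"

lemma avoiding_edge:
  assumes "finite V" "\<And>e. e \<in> E \<Longrightarrow> e \<subseteq> V \<and> card e = k"
    and "\<not> light k (card V) E S" "2 \<le> card S" "card S < k"
    and "finite U" "card U \<le> 2 * k" "U \<inter> S = {}"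
  obtains e where "e \<in> E" "S \<subseteq> e" "e \<inter> U = {}"
proof (rule ccontr)
  assume "\<not> thesis"
  with that have meets: "e \<inter> U \<noteq> {}" if "e \<in> E" "S \<subseteq> e" for e
    using that by blast
  have finS: "finite S" using assms(4) by (intro card_ge_0_finite) linarith
  have finE: "finite E" using assms(1,2) by (intro finite_subset[of E "Pow V"]) auto
  have "card {e \<in> E. S \<subseteq> e} \<le> card (\<Union>u\<in>U. {e \<in> E. insert u S \<subseteq> e})"
    using meets finE assms(6) by (intro card_mono) auto
  also have "\<dots> \<le> (\<Sum>u\<in>U. card {e \<in> E. insert u S \<subseteq> e})"
    by (rule card_UN_le[OF assms(6)])
  also have "\<dots> \<le> (\<Sum>u\<in>U. card V ^ (k - card S - 1))"
  proof (rule sum_mono)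
    fix u assume "u \<in> U"
    then have "u \<notin> S" using assms(8) by blast
    then have "card (insert u S) = Suc (card S)" using finS by simp
    then show "card {e \<in> E. insert u S \<subseteq> e} \<le> card V ^ (k - card S - 1)"
      using card_edges_containing_le[of V E k "insert u S"] assms(1,2) finS by simp
  qed
  also have "\<dots> \<le> 2 * k * card V ^ (k - card S - 1)"
    using assms(7) by simp
  finally show False using assms(3-5) by (simp add: light_def)
qed

text \<open>Keep \<open>e\<close> and \<open>f\<close>, and replace \<open>g\<close> by an edge \<open>h\<close> that contains the apex and the part \<open>e - f\<close> of the base but
no other vertex of \<open>e\<close> or \<open>f\<close>.\<close>
lemma entangled_heavy_imp_contains_tent:
  assumes "finite V" "\<And>e. e \<in> E \<Longrightarrow> e \<subseteq> V \<and> card e = k"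
    and "entangled {e \<in> E. \<forall>S\<subseteq>e. \<not> light k (card V) E S}"
  shows "contains_tent E"
proof -
  let ?H = "{e \<in> E. \<forall>S\<subseteq>e. \<not> light k (card V) E S}"
  obtain e f g v where H: "e \<in> ?H" "f \<in> ?H" "g \<in> ?H"
    and sub: "e \<subseteq> f \<union> g" and v: "v \<in> f" "v \<in> g" "v \<notin> e"
    using assms(3) by (rule entangledE)
  have efg: "e \<in> E" "f \<in> E" "g \<in> E" using H by simp_all
  have heavy: "\<not> light k (card V) E S" if "S \<subseteq> g" for S
    using H(3) that by simp
  have card: "card e = k" "card f = k" "card g = k" using efg assms(2) by auto
  have fin: "finite e" "finite f" "finite g"
    using efg assms(2) finite_subset[OF _ assms(1)] by auto
  define S where "S = insert v (e - f)"
  define U where "U = (e \<union> f) - S"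
  have Sg: "S \<subseteq> g" using sub v by (auto simp: S_def)
  obtain h where h: "h \<in> E" "S \<subseteq> h" "h \<inter> U = {}"
  proof (cases "card S < k")
    case True
    have "e - f \<noteq> {}"
    proof
      assume "e - f = {}"
      then have "e = f" using card fin by (intro card_subset_eq) auto
      then show False using v by simp
    qed
    then have "card (e - f) > 0" using fin by (simp add: card_gt_0_iff)
    then have "2 \<le> card S" using v fin by (simp add: S_def)
    moreover have "card U \<le> 2 * k"
    proof -
      have "card U \<le> card (e \<union> f)" using fin by (intro card_mono) (auto simp: U_def)
      also have "\<dots> \<le> card e + card f" by (rule card_Un_le)
      finally show ?thesis using card by simp
    qed
    ultimately show ?thesis
      using avoiding_edge[of V E k S U] assms(1,2) heavy[OF Sg] True fin that
      by (auto simp: U_def)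
  next
    case False
    (* Here g itself meets e and f only in S. *)
    then have "S = g" using Sg card fin card_mono[OF fin(3) Sg] by (intro card_subset_eq) auto
    then show ?thesis using efg that by (auto simp: U_def)
  qed
  have "e \<subseteq> f \<union> h" using h by (auto simp: S_def)
  moreover have "f \<inter> h = {v}" using h v by (auto simp: S_def U_def)
  ultimately show ?thesis
    unfolding contains_tent_def using efg h(1) v(3) by (intro bexI exI conjI)
qed

text \<open>There are at most \<open>n ^ s\<close> light sets of size \<open>s\<close>, each in at most \<open>2 * k * n ^ (k - s - 1)\<close> edges, and fewer
than \<open>k\<close> values of \<open>s\<close>.\<close>
lemma card_edges_with_light_le:
  assumes "finite V" "\<And>e. e \<in> E \<Longrightarrow> e \<subseteq> V \<and> card e = k"
  shows "card {e \<in> E. \<exists>S\<subseteq>e. light k (card V) E S} \<le> 2 * k\<^sup>2 * card V ^ (k - 1)"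
proof -
  let ?n = "card V"
  have finE: "finite E" using assms by (intro finite_subset[of E "Pow V"]) auto
  define L where "L s = {S. S \<subseteq> V \<and> card S = s \<and> light k ?n E S}" for s
  have finL: "finite (L s)" for s
    using assms(1) by (intro finite_subset[of "L s" "Pow V"]) (auto simp: L_def)
  have "card {e \<in> E. \<exists>S\<subseteq>e. light k ?n E S}
      \<le> card (\<Union>s\<in>{2..<k}. \<Union>S\<in>L s. {e \<in> E. S \<subseteq> e})"
  proof (rule card_mono)
    show "{e \<in> E. \<exists>S\<subseteq>e. light k ?n E S} \<subseteq> (\<Union>s\<in>{2..<k}. \<Union>S\<in>L s. {e \<in> E. S \<subseteq> e})"
    proof
      fix e assume "e \<in> {e \<in> E. \<exists>S\<subseteq>e. light k ?n E S}"
      then obtain S where "e \<in> E" "S \<subseteq> e" "light k ?n E S" by auto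
      moreover have "S \<in> L (card S)" "card S \<in> {2..<k}"
        using calculation assms(2)[of e] by (auto simp: L_def light_def)
      ultimately show "e \<in> (\<Union>s\<in>{2..<k}. \<Union>S\<in>L s. {e \<in> E. S \<subseteq> e})" by blast
    qed
  qed (use finE finL in auto)
  also have "\<dots> \<le> (\<Sum>s\<in>{2..<k}. card (\<Union>S\<in>L s. {e \<in> E. S \<subseteq> e}))"
    by (rule card_UN_le) simp
  also have "\<dots> \<le> (\<Sum>s\<in>{2..<k}. 2 * k * ?n ^ (k - 1))"
  proof (rule sum_mono)
    fix s assume s: "s \<in> {2..<k}"
    have "card (\<Union>S\<in>L s. {e \<in> E. S \<subseteq> e}) \<le> (\<Sum>S\<in>L s. card {e \<in> E. S \<subseteq> e})"
      by (rule card_UN_le[OF finL])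
    also have "\<dots> \<le> (\<Sum>S\<in>L s. 2 * k * ?n ^ (k - s - 1))"
      by (rule sum_mono) (auto simp: L_def light_def)
    also have "\<dots> = card (L s) * (2 * k * ?n ^ (k - s - 1))" by simp
    also have "card (L s) \<le> ?n ^ s"
    proof -
      have "card (L s) \<le> card {S. S \<subseteq> V \<and> card S = s}"
        using assms(1) by (intro card_mono) (auto simp: L_def)
      also have "\<dots> = ?n choose s" using assms(1) by (rule n_subsets)
      also have "\<dots> \<le> (?n choose s) * fact s" by simp
      also have "\<dots> \<le> ?n ^ s" by (rule binomial_fact_pow)
      finally show ?thesis .
    qed
    then have "card (L s) * (2 * k * ?n ^ (k - s - 1)) \<le> ?n ^ s * (2 * k * ?n ^ (k - s - 1))"
      by (rule mult_right_mono) simp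
    also have "\<dots> = 2 * k * ?n ^ (s + (k - s - 1))" by (simp add: power_add)
    also have "s + (k - s - 1) = k - 1" using s by auto
    finally show "card (\<Union>S\<in>L s. {e \<in> E. S \<subseteq> e}) \<le> 2 * k * ?n ^ (k - 1)" .
  qed
  also have "\<dots> = (k - 2) * (2 * k * ?n ^ (k - 1))" by simp
  also have "\<dots> \<le> k * (2 * k * ?n ^ (k - 1))" by (rule mult_right_mono) auto
  finally show ?thesis by (simp add: power2_eq_square mult_ac)
qed

lemma tent_free_card_le:
  fixes G :: "nat hypergraph"
  assumes "0 < k" "kgraph k G" "free_of (two_part_tents k) G"
  shows "real (card (edges G))
     \<le> (real (card (verts G)) / real k) ^ k + 2 * (real k)\<^sup>2 * real (card (verts G)) ^ (k - 1)"
proof -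
  let ?V = "verts G" and ?E = "edges G"
  let ?B = "{e \<in> ?E. \<exists>S\<subseteq>e. light k (card ?V) ?E S}"
  let ?H = "{e \<in> ?E. \<forall>S\<subseteq>e. \<not> light k (card ?V) ?E S}"
  have V: "finite ?V" and E: "\<And>e. e \<in> ?E \<Longrightarrow> e \<subseteq> ?V \<and> card e = k"
    using assms(2) by (auto simp: kgraph_def)
  have "\<not> entangled ?H"
    using free_imp_not_contains_tent[OF assms] entangled_heavy_imp_contains_tent[OF V E]
    by (rule contrapos_nn)
  then have "real (card ?H) \<le> (real (card ?V) / real k) ^ k"
    using E by (intro not_entangled_card_le[OF assms(1) V]) auto
  moreover have "real (card ?B) \<le> 2 * (real k)\<^sup>2 * real (card ?V) ^ (k - 1)"
  proof -
    have "real (card ?B) \<le> real (2 * k\<^sup>2 * card ?V ^ (k - 1))"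
      unfolding of_nat_le_iff by (rule card_edges_with_light_le[OF V E])
    then show ?thesis by simp
  qed
  moreover have "?E = ?H \<union> ?B" by auto
  then have "card ?E \<le> card ?H + card ?B"
    using card_Un_le[of ?H ?B] by simp
  ultimately show ?thesis by linarith
qed

section \<open>The complete partite construction\<close>

text \<open>The complete \<open>k\<close>-partite \<open>k\<close>-graph on \<open>{..<n}\<close> whose vertex classes are the residue classes modulo \<open>k\<close>.\<close>
definition rainbow_edges :: "nat \<Rightarrow> nat \<Rightarrow> nat set set" where
  "rainbow_edges k n = {e. e \<subseteq> {..<n} \<and> card e = k \<and> inj_on (\<lambda>x. x mod k) e}"

text \<open>Every edge meets every class, so \<open>e\<close> has a vertex \<open>u\<close> in the class of \<open>v\<close>.  It lies in \<open>f\<close> or \<open>g\<close>, which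
contains \<open>v\<close> as its only vertex of that class.\<close>
lemma rainbow_not_entangled:
  assumes "0 < k"
  shows "\<not> entangled (rainbow_edges k n)"
proof
  assume "entangled (rainbow_edges k n)"
  then obtain e f g v where efg: "e \<in> rainbow_edges k n" "f \<in> rainbow_edges k n" "g \<in> rainbow_edges k n"
    and sub: "e \<subseteq> f \<union> g" and v: "v \<in> f" "v \<in> g" "v \<notin> e"
    by (rule entangledE)
  have "(\<lambda>x. x mod k) ` e = {..<k}"
  proof (rule card_subset_eq)
    show "(\<lambda>x. x mod k) ` e \<subseteq> {..<k}" using assms by auto
    show "card ((\<lambda>x. x mod k) ` e) = card {..<k}"
      using efg(1) card_image[of "\<lambda>x. x mod k" e] by (simp add: rainbow_edges_def)
  qed simp
  moreover have "v mod k \<in> {..<k}" using assms by simp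
  ultimately obtain u where u: "u \<in> e" "v mod k = u mod k"
    by (metis (no_types, lifting) imageE)
  have "inj_on (\<lambda>x. x mod k) f" "inj_on (\<lambda>x. x mod k) g"
    using efg by (simp_all add: rainbow_edges_def)
  moreover have "u \<in> f \<or> u \<in> g" using sub u by auto
  ultimately have "v = u"
    using v u(2) by (metis inj_onD)
  then show False using u v by simp
qed

text \<open>Every residue class has at least \<open>n div k\<close> elements below \<open>n\<close>; the function \<open>f\<close> picks the element
\<open>f i * k + i\<close> of class \<open>i\<close>.\<close>
lemma card_rainbow_ge:
  assumes "0 < k"
  shows "(n div k) ^ k \<le> card (rainbow_edges k n)"
proof -
  let ?F = "\<lambda>f. (\<lambda>i. f i * k + i) ` {..<k}"
  have "card ({..<k} \<rightarrow>\<^sub>E {..<n div k}) \<le> card (rainbow_edges k n)"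
  proof (rule card_inj_on_le[where f = ?F])
    show "inj_on ?F ({..<k} \<rightarrow>\<^sub>E {..<n div k})"
    proof (rule inj_onI)
      fix f g assume fg: "f \<in> {..<k} \<rightarrow>\<^sub>E {..<n div k}" "g \<in> {..<k} \<rightarrow>\<^sub>E {..<n div k}"
        and eq: "?F f = ?F g"
      show "f = g"
      proof (rule PiE_ext[OF fg])
        fix i assume i: "i \<in> {..<k}"
        then have "f i * k + i \<in> ?F g" using eq by blast
        then obtain j where j: "j < k" "f i * k + i = g j * k + j" by auto
        have "i = (f i * k + i) mod k" "j = (g j * k + j) mod k" using i j(1) by simp_all
        then have "i = j" using j(2) by metis
        then show "f i = g i" using j assms by simp
      qed
    qed
    show "?F ` ({..<k} \<rightarrow>\<^sub>E {..<n div k}) \<subseteq> rainbow_edges k n"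
    proof (rule image_subsetI)
      fix f assume f: "f \<in> {..<k} \<rightarrow>\<^sub>E {..<n div k}"
      have inj: "inj_on (\<lambda>i. f i * k + i) {..<k}"
      proof (rule inj_onI)
        fix i j assume ij: "i \<in> {..<k}" "j \<in> {..<k}" "f i * k + i = f j * k + j"
        have "i = (f i * k + i) mod k" "j = (f j * k + j) mod k" using ij(1,2) by simp_all
        then show "i = j" using ij(3) by metis
      qed
      have "f i * k + i < n" if "i < k" for i
      proof -
        have "f i * k + i < (f i + 1) * k" using that by simp
        also have "\<dots> \<le> (n div k) * k"
          using f that by (intro mult_right_mono) (auto simp: PiE_def Pi_def Suc_le_eq)
        also have "\<dots> \<le> n" by simp
        finally show ?thesis .
      qed
      moreover have "inj_on (\<lambda>x. x mod k) (?F f)"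
        by (rule inj_onI) auto
      ultimately show "?F f \<in> rainbow_edges k n"
        using inj by (auto simp: rainbow_edges_def card_image)
    qed
    show "finite (rainbow_edges k n)"
      by (rule finite_subset[of _ "Pow {..<n}"]) (auto simp: rainbow_edges_def)
  qed
  then show ?thesis by (simp add: card_PiE)
qed

section \<open>The density\<close>
lemma
  assumes "0 < k"
  shows ex_number_ge: "(n div k) ^ k \<le> ex_number k n (two_part_tents k)"
    and ex_number_le: "real (ex_number k n (two_part_tents k))
      \<le> (real n / real k) ^ k + 2 * (real k)\<^sup>2 * real n ^ (k - 1)"
proof -
  define A where "A = {card (edges G) | G :: nat hypergraph.
            kgraph k G \<and> card (verts G) = n \<and> free_of (two_part_tents k) G}"
  have ex: "ex_number k n (two_part_tents k) = Max A"
    by (simp add: ex_number_def A_def)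
  have "A \<subseteq> {..2 ^ n}"
  proof
    fix m assume "m \<in> A"
    then obtain G :: "nat hypergraph" where "kgraph k G" "card (verts G) = n" "m = card (edges G)"
      by (auto simp: A_def)
    then show "m \<in> {..2 ^ n}"
      using card_mono[of "Pow (verts G)" "edges G"] by (auto simp: kgraph_def card_Pow)
  qed
  then have fin: "finite A" using finite_subset by blast
  define G where "G = \<lparr>verts = {..<n}, edges = rainbow_edges k n\<rparr>"
  have "kgraph k G" "card (verts G) = n"
    by (auto simp: G_def kgraph_def rainbow_edges_def)
  moreover have "free_of (two_part_tents k) G"
    using rainbow_not_entangled[OF assms]
    by (intro not_entangled_imp_free[OF assms]) (simp add: G_def)
  ultimately have G: "card (rainbow_edges k n) \<in> A"
    unfolding A_def by (intro CollectI exI[of _ G]) (simp add: G_def)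
  then have "card (rainbow_edges k n) \<le> Max A"
    by (rule Max_ge[OF fin])
  with card_rainbow_ge[OF assms, of n] show "(n div k) ^ k \<le> ex_number k n (two_part_tents k)"
    unfolding ex by (rule order_trans)
  have "Max A \<in> A" using fin G by (intro Max_in) auto
  then obtain H :: "nat hypergraph" where "Max A = card (edges H)"
    and H: "kgraph k H" "card (verts H) = n" "free_of (two_part_tents k) H"
    unfolding A_def by blast
  then show "real (ex_number k n (two_part_tents k))
      \<le> (real n / real k) ^ k + 2 * (real k)\<^sup>2 * real n ^ (k - 1)"
    using tent_free_card_le[OF assms H(1,3)] by (simp add: ex)
qed

lemma choose_over_power_tendsto:
  "(\<lambda>n. real (n choose k) / real n ^ k) \<longlonglongrightarrow> 1 / fact k"
proof -
  have "(\<lambda>n. (real n - real i) / real n) \<longlonglongrightarrow> 1" for i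
  proof -
    have "(\<lambda>n. 1 - real i / real n) \<longlonglongrightarrow> 1 - 0"
      by (intro tendsto_intros lim_const_over_n)
    moreover have "\<forall>\<^sub>F n in sequentially. 1 - real i / real n = (real n - real i) / real n"
      using eventually_gt_at_top[of 0] by eventually_elim (simp add: field_simps)
    ultimately show ?thesis by (simp add: filterlim_cong)
  qed
  then have "(\<lambda>n. (\<Prod>i=0..<k. (real n - real i) / real n) / fact k) \<longlonglongrightarrow> (\<Prod>i=0..<k. 1) / fact k"
    by (intro tendsto_intros) auto
  moreover have "(\<Prod>i=0..<k. (real n - real i) / real n) / fact k = real (n choose k) / real n ^ k" for n
    by (simp add: binomial_gbinomial gbinomial_prod_rev prod_dividef)
  ultimately show ?thesis by simp
qed

theorem turan_ratio_tendsto: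
  assumes "0 < k"
  shows "turan_ratio k (two_part_tents k) \<longlonglongrightarrow> fact k / real k ^ k"
proof -
  define D where "D n = real (n choose k) / real n ^ k" for n
  have D: "D \<longlonglongrightarrow> 1 / fact k"
    unfolding D_def by (rule choose_over_power_tendsto)
  have D_pos: "\<forall>\<^sub>F n in sequentially. 0 < n \<and> 0 < D n"
    using eventually_ge_at_top[of k] eventually_gt_at_top[of 0]
    by eventually_elim (simp add: D_def)
  define lo where "lo n = (real (n div k) / real n) ^ k / D n" for n
  define hi where "hi n = ((1 / real k) ^ k + 2 * (real k)\<^sup>2 / real n) / D n" for n
  have parts: "(\<lambda>n. real (n div k) / real n) \<longlonglongrightarrow> 1 / real k"
  proof (rule tendsto_sandwich)
    show "(\<lambda>n. 1 / real k - 1 / real n) \<longlonglongrightarrow> 1 / real k"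
      using tendsto_diff[OF tendsto_const lim_const_over_n[of 1]] by simp
    show "\<forall>\<^sub>F n in sequentially. 1 / real k - 1 / real n \<le> real (n div k) / real n"
      using eventually_gt_at_top[of 0]
    proof eventually_elim
      case (elim n)
      have "n < (n div k + 1) * k" 
        using dividend_less_div_times[OF assms, of n] by (simp add: algebra_simps)
      then have "real n < (real (n div k) + 1) * real k"
        by (metis of_nat_1 of_nat_add of_nat_less_iff of_nat_mult)
      then have "real n / real k - 1 \<le> real (n div k)"
        using assms by (simp add: field_simps)
      then have "(real n / real k - 1) / real n \<le> real (n div k) / real n"
        by (rule divide_right_mono) simp
      then show ?case using elim by (simp add: diff_divide_distrib)
    qed
    show "\<forall>\<^sub>F n in sequentially. real (n div k) / real n \<le> 1 / real k"
      using eventually_gt_at_top[of 0]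
    proof eventually_elim
      case (elim n)
      have "real (n div k) \<le> real n / real k" by (rule of_nat_div_le_of_nat)
      then show ?case using elim assms by (simp add: field_simps)
    qed
  qed simp
  have "lo \<longlonglongrightarrow> (1 / real k) ^ k / (1 / fact k)"
    unfolding lo_def by (rule tendsto_divide[OF tendsto_power[OF parts] D]) simp
  moreover have "hi \<longlonglongrightarrow> ((1 / real k) ^ k + 0) / (1 / fact k)"
    unfolding hi_def
    by (rule tendsto_divide[OF tendsto_add[OF tendsto_const lim_const_over_n] D]) simp
  moreover have "\<forall>\<^sub>F n in sequentially. lo n \<le> turan_ratio k (two_part_tents k) n"
    using D_pos
  proof eventually_elim
    case (elim n)
    have "real ((n div k) ^ k) / real (n choose k) \<le> turan_ratio k (two_part_tents k) n"
      unfolding turan_ratio_def using ex_number_ge[OF assms]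
      by (intro divide_right_mono) (simp_all only: of_nat_le_iff of_nat_0_le_iff)
    then show ?case using elim by (simp add: lo_def D_def power_divide)
  qed
  moreover have "\<forall>\<^sub>F n in sequentially. turan_ratio k (two_part_tents k) n \<le> hi n"
    using D_pos
  proof eventually_elim
    case (elim n)
    have "real n ^ k = real n * real n ^ (k - 1)"
      using assms by (simp add: power_eq_if)
    then have "(1 / real k) ^ k + 2 * (real k)\<^sup>2 / real n
        = ((real n / real k) ^ k + 2 * (real k)\<^sup>2 * real n ^ (k - 1)) / real n ^ k"
      using elim by (simp add: add_divide_distrib power_divide)
    then have "hi n = ((real n / real k) ^ k + 2 * (real k)\<^sup>2 * real n ^ (k - 1)) / real (n choose k)"
      using elim by (simp add: hi_def D_def)
    then show ?case
      unfolding turan_ratio_def using ex_number_le[OF assms] by (simp add: divide_right_mono)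
  qed
  ultimately show ?thesis
    using tendsto_sandwich[of lo _ sequentially hi] by (simp add: power_divide)
qed

theorem theorem1p6:
  fixes k :: nat
  assumes "k \<ge> 2"
  shows "convergent (turan_ratio k (two_part_tents k)) \<and>
         turan_density k (two_part_tents k) = fact k / real k ^ k"
  using turan_ratio_tendsto[of k] assms
  by (auto simp: turan_density_def convergent_def intro: limI)

end
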